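(* Let $A$ be a set of positive integers that has upper Banach density $1$. Then $A$ contains an infinite sequence of pairwise disjoint subsets $(B_i)_{i=1}^{\infty}$ such that $B_i$ has upper Banach density $1$ for all $i \in \mathbf{N}$ and $$\sum_{i\in I} B_i \subseteq A$$ for every nonempty finite set $I$ of positive integers.
   Context: $\mathbf{N}$ is the set of positive integers and $\mathbf{N}_0$ is the set of nonnegative integers. For integers $x,y$, the interval of integers is $[x,y] = \{n \in \mathbf{N} : x \leq n \leq y\}$. For a set $A$ of positive integers and $n \in \mathbf{N}$, let $f_A(n) = \max_{u \in \mathbf{N}_0} |A \cap [u,u+n-1]|$. The upper Banach density of $A$ is $\delta(A) = \limsup_{n \rightarrow \infty} f_A(n)/n$. For a nonempty finite index set $I$ and sets of integers $B_i$ ($i\in I$), the sumset is $\sum_{i\in I} B_i = \{\sum_{i \in I} b_i : b_i \in B_i \text{ for all } i \in I\}$. *)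

theory Defs
  imports "HOL-Analysis.Analysis"
begin

(* Sets of positive integers are sets of naturals not containing 0.
   The intervals below consist of positive integers only, even if x = 0. *)

definition pos_interval :: "nat \<Rightarrow> nat \<Rightarrow> nat set" where
  "pos_interval x y = {n. 1 \<le> n \<and> x \<le> n \<and> n \<le> y}"

definition max_window_count :: "nat set \<Rightarrow> nat \<Rightarrow> nat" where
  "max_window_count A n = Max (range (\<lambda>u. card (A \<inter> pos_interval u (u + n - 1))))"

(* The maximum is taken over an infinite range of u; the set of values is nevertheless finite. *)

lemma finite_window_counts:
  "finite (range (\<lambda>u. card (A \<inter> pos_interval u (u + n - 1))))"
proof -
  have "card (A \<inter> pos_interval u (u + n - 1)) \<le> Suc n" for u
  proof -
    have "card (A \<inter> pos_interval u (u + n - 1)) \<le> card {u..u + n}"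
      by (rule card_mono) (auto simp: pos_interval_def)
    then show ?thesis
      by simp
  qed
  then have "range (\<lambda>u. card (A \<inter> pos_interval u (u + n - 1))) \<subseteq> {..Suc n}"
    by auto
  then show ?thesis
    by (rule finite_subset) simp
qed

(* The term at n = 0 is 0 / 0 = 0 and does not affect the limsup. *)

definition upper_banach_density :: "nat set \<Rightarrow> ereal" where
  "upper_banach_density A = limsup (\<lambda>n. ereal (real (max_window_count A n) / real n))"

(* The sumset of a finite family B over I is the sum of sets from HOL-Library.Set_Algebras,
   i.e. (\<Sum>i\<in>I. B i) = {sum b I |b. \<forall>i\<in>I. b i \<in> B i}, see set_sum_alt. *)

end

theory Submission
  imports Defs
begin

text \<open>
  A set of positive integers has upper Banach density 1 if and only if it is thick, that is,
  contains intervals of every length: if every block of \<open>k\<close> consecutive integers meets the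
  complement, cutting a long window into such blocks shows that the complement takes up at least
  about a fraction \<open>1/k\<close> of the window (\<open>upper_banach_density_eq_1_iff_thick\<close>). The density therefore leaves the
  problem, and the sets \<open>B\<^sub>i\<close> only have to be thick.

  They are assembled from a fast growing sequence of intervals \<open>J\<^sub>t = [x\<^sub>t, x\<^sub>t + L\<^sub>t]\<close>, where \<open>L\<^sub>t\<close> is
  the sum of the maxima of all earlier intervals and \<open>x\<^sub>t\<close> is chosen so that even
  \<open>[x\<^sub>t, x\<^sub>t + 2 L\<^sub>t]\<close> lies in \<open>A\<close>. In a sum with at most one summand from each interval, the summands
  other than the one from the last interval \<open>J\<^sub>t\<close> contribute at most \<open>L\<^sub>t\<close>, so the total stays in
  \<open>[x\<^sub>t, x\<^sub>t + 2 L\<^sub>t]\<close> and hence in \<open>A\<close>. Distributing the intervals among the \<open>B\<^sub>i\<close> in such a way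
  that each \<open>B\<^sub>i\<close> receives infinitely many makes every \<open>B\<^sub>i\<close> thick and the \<open>B\<^sub>i\<close> disjoint, and an
  element of \<open>\<Sum>i\<in>I. B\<^sub>i\<close> is a sum of the kind just considered.
\<close>

definition thick :: "nat set \<Rightarrow> bool" where
  "thick A \<longleftrightarrow> (\<forall>n. \<exists>x. {x..<x + n} \<subseteq> A)"

lemma max_window_count_le_iff:
  assumes "A \<subseteq> {1..}" "n \<ge> 1"
  shows "max_window_count A n \<le> m \<longleftrightarrow> (\<forall>u. card (A \<inter> {u..<u + n}) \<le> m)"
proof -
  have "A \<inter> pos_interval u (u + n - 1) = A \<inter> {u..<u + n}" for u
    using assms by (auto simp: pos_interval_def)
  then show ?thesis
    unfolding max_window_count_def
    by (subst Max_le_iff[OF finite_window_counts]) auto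
qed

lemma window_count_le_max:
  assumes "A \<subseteq> {1..}" "n \<ge> 1"
  shows "card (A \<inter> {u..<u + n}) \<le> max_window_count A n"
  using max_window_count_le_iff[OF assms, of "max_window_count A n"] by simp

text \<open>
  The points outside \<open>A\<close>, one from each of the \<open>n div k\<close> consecutive blocks that fit into the window,
  are distinct.
\<close>

lemma card_window_le_if_blocks_meet_complement:
  assumes "k \<ge> 1" and gap: "\<And>x. \<not> {x..<x + k} \<subseteq> A"
  shows "card (A \<inter> {u..<u + n}) + n div k \<le> n"
proof -
  have "\<forall>x. \<exists>y. x \<le> y \<and> y < x + k \<and> y \<notin> A"
    using gap by (auto simp: subset_iff)
  then obtain h where h: "\<And>x. x \<le> h x \<and> h x < x + k \<and> h x \<notin> A"
    by metis
  define c where "c j = h (u + j * k)" for j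
  have block: "(c j - u) div k = j" for j
  proof -
    have "j * k \<le> c j - u" "c j - u < Suc j * k"
      using h[of "u + j * k"] by (auto simp: c_def)
    then show ?thesis
      by (intro div_nat_eqI) (simp_all add: mult.commute)
  qed
  have "c ` {..<n div k} \<subseteq> {u..<u + n} - A"
  proof safe
    fix j assume j: "j < n div k"
    have "Suc j * k \<le> n div k * k"
      using j by (intro mult_right_mono) auto
    also have "\<dots> \<le> n"
      by simp
    finally show "c j \<in> {u..<u + n}"
      using h[of "u + j * k"] by (auto simp: c_def)
    assume "c j \<in> A"
    then show False
      using h by (auto simp: c_def)
  qed
  moreover have "inj_on c {..<n div k}"
    by (rule inj_on_inverseI[of _ "\<lambda>y. (y - u) div k"]) (simp add: block)
  ultimately have "n div k \<le> card ({u..<u + n} - A)"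
    by (metis card_image card_lessThan card_mono finite_Diff finite_atLeastLessThan)
  moreover have "card (A \<inter> {u..<u + n}) + card ({u..<u + n} - A) = n"
    using card_Int_Diff[of "{u..<u + n}" A] by (simp add: Int_commute)
  ultimately show ?thesis
    by linarith
qed

lemma upper_banach_density_less_1_if_not_thick:
  assumes "A \<subseteq> {1..}" "\<not> thick A"
  shows "upper_banach_density A < 1"
proof -
  obtain k where gap: "\<And>x. \<not> {x..<x + k} \<subseteq> A"
    using assms(2) by (auto simp: thick_def)
  have k: "k \<ge> 1"
    using gap[of 0] by (cases k) auto
  \<comment> \<open>Half of \<open>1/k\<close> absorbs the loss from rounding \<open>n/k\<close> down to \<open>n div k\<close>.\<close>
  have "max_window_count A n / n \<le> 1 - 1 / (2 * k)" if n: "n \<ge> 2 * k" for n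
  proof -
    have "max_window_count A n \<le> n - n div k"
      using card_window_le_if_blocks_meet_complement[OF k gap, of _ n] n k
      by (subst max_window_count_le_iff[OF assms(1)]) (auto simp: le_diff_conv2)
    moreover have "n div k \<le> n"
      by (rule div_le_dividend)
    ultimately have "real (max_window_count A n) \<le> real n - real (n div k)"
      by linarith
    moreover have "real n / (2 * k) \<le> real (n div k)"
    proof -
      have "n div k * k + n mod k = n" "n mod k < k"
        using k by (simp_all only: div_mult_mod_eq) simp
      then have "n \<le> 2 * (n div k * k)"
        using n by linarith
      then have "real n \<le> real (2 * (n div k * k))"
        by (rule of_nat_mono)
      then have "real n \<le> real (n div k) * real (2 * k)"
        by (simp only: of_nat_mult mult_ac)
      then show ?thesis
        using k by (simp add: pos_divide_le_eq)
    qed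
    ultimately have "real (max_window_count A n) \<le> (1 - 1 / (2 * k)) * n"
      by (simp add: algebra_simps)
    then show ?thesis
      using n k by (simp add: pos_divide_le_eq)
  qed
  then have "upper_banach_density A \<le> ereal (1 - 1 / (2 * k))"
    unfolding upper_banach_density_def
    by (intro Limsup_bounded eventually_sequentiallyI[of "2 * k"]) simp
  also have "\<dots> < 1"
    using k by simp
  finally show ?thesis .
qed

lemma upper_banach_density_eq_1_if_thick:
  assumes "A \<subseteq> {1..}" "thick A"
  shows "upper_banach_density A = 1"
proof -
  have "max_window_count A n = n" if n: "n \<ge> 1" for n
  proof (rule antisym)
    have "card (A \<inter> {u..<u + n}) \<le> n" for u
      using card_mono[of "{u..<u + n}" "A \<inter> {u..<u + n}"] by simp
    then show "max_window_count A n \<le> n"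
      by (simp add: max_window_count_le_iff[OF assms(1) n])
    obtain x where "{x..<x + n} \<subseteq> A"
      using assms(2) by (auto simp: thick_def)
    then have "card (A \<inter> {x..<x + n}) = n"
      by (simp add: Int_absorb1)
    then show "n \<le> max_window_count A n"
      using window_count_le_max[OF assms(1) n, of x] by simp
  qed
  then have "\<forall>\<^sub>F n in sequentially. ereal (max_window_count A n / n) = 1"
    by (intro eventually_sequentiallyI[of 1]) simp
  then have "upper_banach_density A = limsup (\<lambda>n. 1)"
    unfolding upper_banach_density_def by (rule Limsup_eq)
  then show ?thesis
    by (simp add: Limsup_const)
qed

lemma upper_banach_density_eq_1_iff_thick:
  assumes "A \<subseteq> {1..}"
  shows "upper_banach_density A = 1 \<longleftrightarrow> thick A"
  using upper_banach_density_less_1_if_not_thick[OF assms]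
    upper_banach_density_eq_1_if_thick[OF assms]
  by (metis less_irrefl)

text \<open>
  The upper half of an interval of \<open>2 n + 2\<close> integers consists of \<open>n + 1\<close> integers beyond \<open>n\<close>,
  wherever the interval starts.
\<close>

lemma thick_obtains_far_interval:
  assumes "thick A"
  obtains x where "x > n" "{x..x + n} \<subseteq> A"
proof -
  obtain y where "{y..<y + (2 * n + 2)} \<subseteq> A"
    using assms unfolding thick_def by blast
  then have "{y + n + 1..y + n + 1 + n} \<subseteq> A"
    by (force simp: subset_iff)
  then show ?thesis
    by (intro that[of "y + n + 1"]) auto
qed

text \<open>
  The intervals \<open>J\<^sub>t = [x\<^sub>t, x\<^sub>t + L\<^sub>t]\<close> are described by the sequences \<open>x\<close> and \<open>L\<close>. The recursion for
  \<open>L\<close> adds the maximum \<open>x\<^sub>t + L\<^sub>t\<close> of \<open>J\<^sub>t\<close> in each step, so \<open>L\<^sub>t\<close> bounds every sum of elements taken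
  from distinct earlier intervals. Each step more than doubles \<open>L\<close>, so the intervals also become
  arbitrarily long.
\<close>

lemma thick_obtains_intervals:
  assumes "thick A"
  obtains x L :: "nat \<Rightarrow> nat" where
    "\<And>t. {x t..x t + 2 * L t} \<subseteq> A"
    "\<And>t. L t < x t"
    "\<And>t. L (Suc t) = L t + (x t + L t)"
proof -
  have "\<forall>n. \<exists>y. y > n \<and> {y..y + n} \<subseteq> A"
    using thick_obtains_far_interval[OF assms] by metis
  then obtain g where g: "\<And>n. g n > n" "\<And>n. {g n..g n + n} \<subseteq> A"
    by metis
  define L where "L t = ((\<lambda>l. l + (g (2 * l) + l)) ^^ t) 0" for t
  show ?thesis
  proof (rule that[of "\<lambda>t. g (2 * L t)" L])
    show "{g (2 * L t)..g (2 * L t) + 2 * L t} \<subseteq> A" for t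
      by (rule g)
    show "L t < g (2 * L t)" for t
      using g(1)[of "2 * L t"] by simp
    show "L (Suc t) = L t + (g (2 * L t) + L t)" for t
      by (simp add: L_def)
  qed
qed

text \<open>
  The summand from the last interval dominates, and all others together only use up the slack
  between \<open>[x\<^sub>m, x\<^sub>m + L\<^sub>m]\<close> and \<open>[x\<^sub>m, x\<^sub>m + 2 L\<^sub>m]\<close>.
\<close>

lemma sum_of_interval_points_mem:
  fixes x L :: "nat \<Rightarrow> nat"
  assumes wide: "\<And>t. {x t..x t + 2 * L t} \<subseteq> A"
    and L_Suc: "\<And>t. L (Suc t) = L t + (x t + L t)"
    and T: "finite T" "T \<noteq> {}"
    and c: "\<And>t. t \<in> T \<Longrightarrow> c t \<in> {x t..x t + L t}"
  shows "sum c T \<in> A"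
proof -
  define m where "m = Max T"
  have m: "m \<in> T" and less: "T - {m} \<subseteq> {..<m}"
    using T by (auto simp: m_def order_less_le)
  have sum_le_L: "(\<Sum>t<n. x t + L t) \<le> L n" for n
    by (induction n) (auto simp: L_Suc)
  have "sum c (T - {m}) \<le> (\<Sum>t\<in>T - {m}. x t + L t)"
    using c by (intro sum_mono) auto
  also have "\<dots> \<le> (\<Sum>t<m. x t + L t)"
    using less by (intro sum_mono2) auto
  also have "\<dots> \<le> L m"
    by (rule sum_le_L)
  finally have "sum c (T - {m}) \<le> L m" .
  moreover have "sum c T = c m + sum c (T - {m})"
    using T m by (simp add: sum.remove)
  ultimately have "sum c T \<in> {x m..x m + 2 * L m}"
    using c[OF m] by auto
  then show ?thesis
    using wide by blast
qed

theorem theorem2: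
  fixes A :: "nat set"
  assumes "A \<subseteq> {1..}"
    and "upper_banach_density A = 1"
  shows "\<exists>B :: nat \<Rightarrow> nat set.
           (\<forall>i\<in>{1..}. B i \<subseteq> A) \<and>
           disjoint_family_on B {1..} \<and>
           (\<forall>i\<in>{1..}. upper_banach_density (B i) = 1) \<and>
           (\<forall>I. finite I \<and> I \<noteq> {} \<and> I \<subseteq> {1..} \<longrightarrow> (\<Sum>i\<in>I. B i) \<subseteq> A)"
proof -
  have "thick A"
    using assms upper_banach_density_eq_1_iff_thick by blast
  then obtain x L :: "nat \<Rightarrow> nat" where
    wide: "\<And>t. {x t..x t + 2 * L t} \<subseteq> A" and
    x_gt: "\<And>t. L t < x t" and
    L_Suc: "\<And>t. L (Suc t) = L t + (x t + L t)"
    using thick_obtains_intervals by blast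
  define J where "J t = {x t..x t + L t}" for t
  \<comment> \<open>Every index is the first component of infinitely many pairs, so its owner
    function \<open>p\<close> hands out infinitely many intervals to each set.\<close>
  define p where "p t = fst (prod_decode t)" for t
  define B where "B i = (\<Union>t\<in>{t. p t = i}. J t)" for i

  have "strict_mono L"
    unfolding strict_mono_Suc_iff
  proof
    show "L t < L (Suc t)" for t
      using x_gt[of t] L_Suc[of t] by linarith
  qed
  then have L_ge: "t \<le> L t" for t
    by (rule strict_mono_imp_increasing)
  have J_A: "J t \<subseteq> A" for t
    using wide[of t] by (auto simp: J_def subset_iff)
  \<comment> \<open>The next interval starts beyond \<open>L (Suc s)\<close>, which is at least the maximum of \<open>J s\<close>.\<close>
  have J_less: "y < z" if "s < t" "y \<in> J s" "z \<in> J t" for s t y z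
  proof -
    have "L (Suc s) \<le> L t"
      using \<open>strict_mono L\<close> that(1) by (simp add: strict_mono_less_eq)
    then show ?thesis
      using that x_gt[of t] L_Suc[of s] by (auto simp: J_def)
  qed
  have J_disjoint: "s = t" if "y \<in> J s" "y \<in> J t" for s t y
    using J_less that by (metis less_irrefl linorder_neqE_nat)

  have B_A: "B i \<subseteq> A" for i
    using J_A by (auto simp: B_def)
  have "disjoint_family_on B {1..}"
    using J_disjoint by (auto simp: disjoint_family_on_def B_def)
  have "thick (B i)" for i
    unfolding thick_def
  proof
    fix n
    define t where "t = prod_encode (i, n)"
    have "n \<le> L t"
      using le_prod_encode_2[of n i] L_ge[of t] by (simp add: t_def)
    then have "{x t..<x t + n} \<subseteq> J t"
      by (auto simp: J_def)
    moreover have "J t \<subseteq> B i"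
    proof -
      have "p t = i"
        by (simp add: p_def t_def)
      then show ?thesis
        by (auto simp: B_def)
    qed
    ultimately show "\<exists>y. {y..<y + n} \<subseteq> B i"
      by blast
  qed
  then have B_density: "upper_banach_density (B i) = 1" for i
    using B_A assms(1) by (intro upper_banach_density_eq_1_if_thick) auto
  have B_sum: "(\<Sum>i\<in>I. B i) \<subseteq> A" if I: "finite I" "I \<noteq> {}" for I
  proof
    fix s assume "s \<in> (\<Sum>i\<in>I. B i)"
    then obtain b where s: "s = sum b I" and b: "\<And>i. i \<in> I \<Longrightarrow> b i \<in> B i"
      using I by (auto simp: set_sum_alt)
    have "\<forall>i\<in>I. \<exists>t. p t = i \<and> b i \<in> J t"
      using b by (auto simp: B_def)
    then obtain \<tau> where \<tau>: "\<forall>i\<in>I. p (\<tau> i) = i \<and> b i \<in> J (\<tau> i)"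
      by (rule bchoice[THEN exE])
    then have "inj_on \<tau> I"
      by (intro inj_on_inverseI[of _ p]) blast
    \<comment> \<open>Reindexing by intervals; \<open>p\<close> inverts \<open>\<tau>\<close>.\<close>
    then have "sum (\<lambda>t. b (p t)) (\<tau> ` I) = s"
      using \<tau> by (simp add: s sum.reindex)
    moreover have "sum (\<lambda>t. b (p t)) (\<tau> ` I) \<in> A"
    proof (rule sum_of_interval_points_mem[of x L])
      show "b (p t) \<in> {x t..x t + L t}" if "t \<in> \<tau> ` I" for t
        using that \<tau> by (auto simp: J_def)
    qed (use I wide L_Suc in auto)
    ultimately show "s \<in> A"
      by simp
  qed
  show ?thesis
    using B_A \<open>disjoint_family_on B {1..}\<close> B_density B_sum by blast
qed

end
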